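(* Let $G$ be a graph with maximum degree $\Delta(G)\geq 3$. Then $\chi'_{\mathrm{inj}}(G)\leq 2(\Delta(G)-1)^2$.
   Context: All graphs are finite and simple. Three edges $e_1,e_2,e_3$ of a graph are consecutive if they form (in this order) a path of length three or a cycle of length three. An injective edge-coloring of $G$ with $k$ colors is a map $c:E(G)\to\{1,\dots,k\}$ (not necessarily a proper edge-coloring) such that $c(e_1)\neq c(e_3)$ whenever $e_1,e_2,e_3$ are consecutive edges in $G$. The injective chromatic index $\chi'_{\mathrm{inj}}(G)$ is the minimum $k$ such that $G$ has an injective edge-coloring with $k$ colors. *)

theory Defs
  imports "HOL-Library.FuncSet"
begin

locale simple_graph =
  fixes V :: "'a set" and E :: "'a set set"
  assumes finite_vertices: "finite V"
    and edges: "E \<subseteq> {e. e \<subseteq> V \<and> card e = 2}"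

definition vdegree :: "'a set set \<Rightarrow> 'a \<Rightarrow> nat" where
  "vdegree E v = card {e \<in> E. v \<in> e}"

(* The inserted 0 matters only for the graph without vertices, where the maximum
   would otherwise be unspecified. *)
definition max_degree :: "'a set \<Rightarrow> 'a set set \<Rightarrow> nat" where
  "max_degree V E = Max (insert 0 (vdegree E ` V))"

definition path3 :: "'a set set \<Rightarrow> 'a set \<Rightarrow> 'a set \<Rightarrow> 'a set \<Rightarrow> bool" where
  "path3 E e1 e2 e3 \<longleftrightarrow> {e1, e2, e3} \<subseteq> E \<and>
     (\<exists>a b c d. distinct [a, b, c, d] \<and> e1 = {a, b} \<and> e2 = {b, c} \<and> e3 = {c, d})"

definition cycle3 :: "'a set set \<Rightarrow> 'a set \<Rightarrow> 'a set \<Rightarrow> 'a set \<Rightarrow> bool" where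
  "cycle3 E e1 e2 e3 \<longleftrightarrow> {e1, e2, e3} \<subseteq> E \<and>
     (\<exists>a b c. distinct [a, b, c] \<and> e1 = {a, b} \<and> e2 = {b, c} \<and> e3 = {c, a})"

definition consecutive :: "'a set set \<Rightarrow> 'a set \<Rightarrow> 'a set \<Rightarrow> 'a set \<Rightarrow> bool" where
  "consecutive E e1 e2 e3 \<longleftrightarrow> path3 E e1 e2 e3 \<or> cycle3 E e1 e2 e3"

definition injective_edge_coloring :: "'a set set \<Rightarrow> nat \<Rightarrow> ('a set \<Rightarrow> nat) \<Rightarrow> bool" where
  "injective_edge_coloring E k c \<longleftrightarrow> c \<in> E \<rightarrow> {1..k} \<and>
     (\<forall>e1 e2 e3. consecutive E e1 e2 e3 \<longrightarrow> c e1 \<noteq> c e3)"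

definition injective_chromatic_index :: "'a set set \<Rightarrow> nat" where
  "injective_chromatic_index E = (LEAST k. \<exists>c. injective_edge_coloring E k c)"

(* The minimum is over a nonempty set: colour all edges differently. *)
lemma (in simple_graph) ex_injective_edge_coloring:
  "\<exists>c. injective_edge_coloring E (card E) c"
proof -
  have "finite E"
    using finite_vertices edges by (auto intro: finite_subset[of E "Pow V"])
  then obtain c where c: "bij_betw c E {1..card E}"
    using ex_bij_betw_finite_nat[of E] bij_betw_iff_card[of E "{1..card E}"] by auto
  have ne: "e1 \<noteq> e3" if "consecutive E e1 e2 e3" for e1 e2 e3
    using that unfolding consecutive_def path3_def cycle3_def
    by (auto simp: doubleton_eq_iff)
  have inE: "e1 \<in> E" "e3 \<in> E" if "consecutive E e1 e2 e3" for e1 e2 e3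
    using that unfolding consecutive_def path3_def cycle3_def by auto
  have "injective_edge_coloring E (card E) c"
    unfolding injective_edge_coloring_def
    using bij_betw_imp_funcset[OF c] bij_betw_imp_inj_on[OF c] ne inE
    by (metis inj_onD)
  then show ?thesis by blast
qed

end

theory Submission
  imports Defs
begin

text \<open>
  Call two edges in conflict if they are the outer edges of three consecutive edges, and let
  \<open>D\<close> be the maximum degree. An edge is in conflict with at most \<open>k = 2 (D - 1)\<^sup>2\<close> others, so
  greedy colouring needs at most \<open>k + 1\<close> colours; one colour is saved as in Brooks' theorem.
  In a minimal set \<open>S\<close> of edges that is not \<open>k\<close>-colourable, every edge is in conflict with exactly
  \<open>k\<close> edges of \<open>S\<close>. Hence \<open>S\<close> is closed under conflict, its edges lie in no triangle, and the
  vertices near them have degree \<open>D\<close>. Let \<open>w\<close> be an endpoint of an edge of \<open>S\<close>, with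
  neighbours \<open>x\<close>, \<open>x'\<close>, \<open>u\<close>, and let \<open>v \<noteq> w\<close> be a neighbour of \<open>u\<close>. The edges \<open>wx\<close> and \<open>wx'\<close>
  are not in conflict, so both may get colour 1, and both are in conflict with \<open>uv\<close>. In the
  absence of triangles, all conflict neighbours of \<open>wx\<close> and \<open>wx'\<close> can be reached from \<open>uv\<close> via
  \<open>uw\<close> without using these two edges. So greedy colouring towards \<open>uv\<close> succeeds: \<open>uv\<close> comes
  last and sees the colour 1 twice.
\<close>

section \<open>Greedy colouring towards a root\<close>

definition proper_coloring :: "('b \<Rightarrow> 'b \<Rightarrow> bool) \<Rightarrow> nat \<Rightarrow> 'b set \<Rightarrow> ('b \<Rightarrow> nat) \<Rightarrow> bool" where
  "proper_coloring R k A c \<longleftrightarrow> c \<in> A \<rightarrow> {1..k} \<and> (\<forall>x\<in>A. \<forall>y\<in>A. R x y \<longrightarrow> c x \<noteq> c y)"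

lemma proper_coloring_insert:
  assumes "symp R" "irreflp R" "finite A" "proper_coloring R k A c" "x \<notin> A"
    and lt: "card (c ` {y \<in> A. R x y}) < k"
  obtains i where "proper_coloring R k (insert x A) (c(x := i))"
proof -
  have "\<not> {1..k} \<subseteq> c ` {y \<in> A. R x y}"
    using card_mono[of "c ` {y \<in> A. R x y}" "{1..k}"] lt assms(3) by auto
  then obtain i where i: "i \<in> {1..k}" "i \<notin> c ` {y \<in> A. R x y}" by blast
  have "proper_coloring R k (insert x A) (c(x := i))"
    using i assms(1,2,4,5) unfolding proper_coloring_def
    by (auto simp: Pi_iff irreflp_def dest: sympD)
  then show thesis by (rule that)
qed

text \<open>These are the finite sets whose elements are all reachable from \<open>r\<close> inside
  the set. The inductive form records an order of growth, which is the colouring order in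
  reverse.\<close>

inductive grown :: "('b \<Rightarrow> 'b \<Rightarrow> bool) \<Rightarrow> 'b \<Rightarrow> 'b set \<Rightarrow> bool" for R r where
  root: "grown R r {r}"
| step: "grown R r U \<Longrightarrow> x \<in> U \<Longrightarrow> y \<notin> U \<Longrightarrow> R x y \<Longrightarrow> grown R r (insert y U)"

lemma grown_root_mem: "grown R r U \<Longrightarrow> r \<in> U"
  by (induction rule: grown.induct) auto

lemma grown_finite: "grown R r U \<Longrightarrow> finite U"
  by (induction rule: grown.induct) auto

text \<open>The elements are coloured in the reverse order of growth, so that each of them still has an
  uncoloured neighbour when its turn comes.\<close>

lemma grown_extend_coloring:
  assumes "grown R r U" "symp R" "irreflp R"
    and "finite A" "A \<inter> U = {}" "proper_coloring R k A c"
    and "\<And>x. x \<in> U \<Longrightarrow> card {y \<in> A \<union> U. R x y} \<le> k"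
  shows "\<exists>c'. proper_coloring R k (A \<union> U - {r}) c' \<and> (\<forall>x\<in>A. c' x = c x)"
  using assms
proof (induction arbitrary: A c rule: grown.induct)
  case root
  then have "A \<union> {r} - {r} = A" by auto
  then show ?case using root by metis
next
  case (step U x y)
  have finU: "finite U" using step.hyps(1) by (rule grown_finite)
  have "R y x" using \<open>R x y\<close> \<open>symp R\<close> by (auto dest: sympD)
  have "{z \<in> A. R y z} \<subset> {z \<in> A \<union> insert y U. R y z}"
    using \<open>R y x\<close> \<open>x \<in> U\<close> step.prems(4) by blast
  then have "card {z \<in> A. R y z} < card {z \<in> A \<union> insert y U. R y z}"
    using finU step.prems(3) by (intro psubset_card_mono) auto
  also have "\<dots> \<le> k" by (rule step.prems(6)) simp
  finally have "card (c ` {z \<in> A. R y z}) < k"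
    using card_image_le[of "{z \<in> A. R y z}" c] step.prems(3) by simp
  then obtain i where i: "proper_coloring R k (insert y A) (c(y := i))"
    using proper_coloring_insert[of R A k c y] step.prems by auto
  have "\<exists>c'. proper_coloring R k (insert y A \<union> U - {r}) c' \<and> (\<forall>x\<in>insert y A. c' x = (c(y := i)) x)"
  proof (rule step.IH)
    show "insert y A \<inter> U = {}" using step by auto
    show "card {z \<in> insert y A \<union> U. R x z} \<le> k" if "x \<in> U" for x
      using step.prems(6)[of x] that by simp
    show "proper_coloring R k (insert y A) (c(y := i))" by (rule i)
  qed (use step.prems in auto)
  moreover have "y \<notin> A" using step.prems by auto
  ultimately show ?case by (metis Un_insert_left Un_insert_right fun_upd_other insertCI)
qed

text \<open>A minimal uncolourable subset would be \<open>k\<close>-regular, so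
  \<open>regular\<close> applies to it. Reachability is demanded only for the neighbours of
  \<open>f\<close> and \<open>g\<close>: the unreachable elements are then not adjacent to
  \<open>f\<close> or \<open>g\<close>, and minimality colours them independently of the common
  colour of \<open>f\<close> and \<open>g\<close>. This replaces any connectivity
  assumption.\<close>

lemma brooks_coloring:
  assumes R: "symp R" "irreflp R" and "finite W" "k > 0"
    and deg: "\<And>x. x \<in> W \<Longrightarrow> card {y \<in> W. R x y} \<le> k"
    and regular: "\<And>S. S \<subseteq> W \<Longrightarrow> S \<noteq> {} \<Longrightarrow> (\<And>x. x \<in> S \<Longrightarrow> card {y \<in> S. R x y} = k) \<Longrightarrow>
      \<exists>r f g. {r, f, g} \<subseteq> S \<and> f \<noteq> g \<and> R r f \<and> R r g \<and> \<not> R f g \<and>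
        (\<forall>y \<in> S - {f, g}. R f y \<or> R g y \<longrightarrow> (\<lambda>a b. R a b \<and> b \<in> S - {f, g})\<^sup>*\<^sup>* r y)"
  shows "\<exists>c. proper_coloring R k W c"
proof -
  have "\<exists>c. proper_coloring R k S c" if "S \<subseteq> W" for S
    using finite_subset[OF that \<open>finite W\<close>] that
  proof (induction S rule: finite_psubset_induct)
    case (psubset S)
    have degS: "card {y \<in> S. R x y} \<le> k" if "x \<in> S" for x
    proof -
      have "card {y \<in> S. R x y} \<le> card {y \<in> W. R x y}"
        using psubset.prems \<open>finite W\<close> by (intro card_mono) auto
      then show ?thesis using deg[of x] that psubset.prems by auto
    qed
    show ?case
    proof (rule ccontr)
      assume no: "\<nexists>c. proper_coloring R k S c"
      have "S \<noteq> {}" using no by (auto simp: proper_coloring_def)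
      \<comment> \<open>Otherwise a colouring of \<open>S - {x}\<close>, which exists by minimality,
        leaves a colour free for \<open>x\<close>.\<close>
      have "card {y \<in> S. R x y} = k" if "x \<in> S" for x
      proof (rule ccontr)
        assume "card {y \<in> S. R x y} \<noteq> k"
        then have lt: "card {y \<in> S. R x y} < k" using degS[OF that] by simp
        have "\<exists>c. proper_coloring R k (S - {x}) c"
          by (rule psubset.IH) (use that psubset.prems in auto)
        then obtain c where c: "proper_coloring R k (S - {x}) c" by blast
        have "{y \<in> S - {x}. R x y} = {y \<in> S. R x y}"
          using R(2) by (auto simp: irreflp_def)
        then have "card (c ` {y \<in> S - {x}. R x y}) < k"
          using lt card_image_le[of "{y \<in> S. R x y}" c] psubset.hyps by simp
        then obtain i where "proper_coloring R k (insert x (S - {x})) (c(x := i))"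
          using proper_coloring_insert[OF R _ c, of x] psubset.hyps by blast
        then show False using no that by (auto simp: insert_absorb)
      qed
      from regular[OF psubset.prems \<open>S \<noteq> {}\<close> this]
      obtain r f g where rfg: "{r, f, g} \<subseteq> S" "f \<noteq> g" "R r f" "R r g" "\<not> R f g"
        and reach: "\<And>y. y \<in> S - {f, g} \<Longrightarrow> R f y \<or> R g y \<Longrightarrow>
            (\<lambda>a b. R a b \<and> b \<in> S - {f, g})\<^sup>*\<^sup>* r y"
        by blast
      have ne: "r \<noteq> f" "r \<noteq> g" using rfg R(2) by (auto simp: irreflp_def)
      \<comment> \<open>A maximal member \<open>U\<close> is the component of \<open>r\<close> after
        the removal of \<open>f\<close> and \<open>g\<close>.\<close>
      let ?X = "{U. grown R r U \<and> U \<subseteq> S - {f, g}}"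
      have "finite ?X" using psubset.hyps by (auto intro: finite_subset[of _ "Pow S"])
      moreover have "{r} \<in> ?X" using ne rfg by (auto intro: grown.root)
      ultimately have "\<exists>U\<in>?X. \<forall>U'\<in>?X. U \<subseteq> U' \<longrightarrow> U = U'"
        by (intro finite_has_maximal) blast+
      then obtain U where U: "U \<in> ?X" and max: "\<And>U'. U' \<in> ?X \<Longrightarrow> U \<subseteq> U' \<Longrightarrow> U = U'"
        by (elim bexE) blast
      have "r \<in> U" "finite U" using U grown_root_mem grown_finite by auto
      have closed: "y \<in> U" if "x \<in> U" "y \<in> S - {f, g}" "R x y" for x y
      proof (rule ccontr)
        assume "y \<notin> U"
        then have "insert y U \<in> ?X" using U that by (auto intro: grown.step)
        then show False using max \<open>y \<notin> U\<close> by blast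
      qed
      have "y \<in> U" if "(\<lambda>a b. R a b \<and> b \<in> S - {f, g})\<^sup>*\<^sup>* r y" for y
        using that by (induction rule: rtranclp_induct) (use \<open>r \<in> U\<close> closed in auto)
      then have nbrs: "y \<in> U" if "y \<in> S - {f, g}" "R f y \<or> R g y" for y
        using reach that by blast
      let ?T = "S - (U \<union> {f, g})"
      have "\<exists>c. proper_coloring R k ?T c"
        by (rule psubset.IH) (use rfg psubset.prems in auto)
      then obtain c0 where c0: "proper_coloring R k ?T c0" by blast
      have noT: "\<not> R f y" "\<not> R g y" "\<not> R y f" "\<not> R y g" if "y \<in> ?T" for y
        using nbrs[of y] that R(1) by (auto dest: sympD)
      have sym_fg: "\<not> R g f" "\<not> R f f" "\<not> R g g"
        using rfg R by (auto simp: irreflp_def dest: sympD)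
      \<comment> \<open>Colour 1 is safe: \<open>f\<close> and \<open>g\<close> are adjacent neither
        to each other nor to \<open>?T\<close>, and \<open>k > 0\<close> puts 1 in range.\<close>
      have c1: "proper_coloring R k (?T \<union> {f, g}) (c0(f := 1, g := 1))"
        using c0 noT sym_fg rfg \<open>k > 0\<close> unfolding proper_coloring_def by (auto simp: Pi_iff)
      have SU: "?T \<union> {f, g} \<union> U = S" using U rfg by auto
      have "\<exists>c. proper_coloring R k (?T \<union> {f, g} \<union> U - {r}) c \<and>
          (\<forall>x \<in> ?T \<union> {f, g}. c x = (c0(f := 1, g := 1)) x)"
        by (rule grown_extend_coloring[OF _ R _ _ c1])
          (use U psubset.hyps degS SU in auto)
      then obtain c where c: "proper_coloring R k (S - {r}) c" and cfg: "c f = c g"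
        unfolding SU by auto
      let ?N = "{y \<in> S - {r}. R r y}"
      have fin: "finite ?N" using psubset.hyps by simp
      \<comment> \<open>Dropping \<open>f\<close> loses no colour, because \<open>g\<close> has the
        same one. So the at most \<open>k\<close> neighbours of \<open>r\<close> show fewer than
        \<open>k\<close> colours.\<close>
      have "c ` ?N \<subseteq> c ` (?N - {f})"
      proof
        fix z assume "z \<in> c ` ?N"
        then obtain y where y: "z = c y" "y \<in> ?N" by auto
        show "z \<in> c ` (?N - {f})"
        proof (cases "y = f")
          case True
          have "g \<in> ?N - {f}" using rfg ne by auto
          then show ?thesis using y(1) True cfg by auto
        qed (use y in auto)
      qed
      then have "card (c ` ?N) \<le> card (?N - {f})"
        using fin by (meson card_image_le card_mono finite_Diff finite_imageI order_trans)
      also have "\<dots> < card ?N" using fin rfg ne by (intro card_Diff1_less) auto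
      also have "\<dots> \<le> card {y \<in> S. R r y}"
        using psubset.hyps by (intro card_mono) auto
      also have "\<dots> \<le> k" using degS rfg by auto
      finally obtain i where "proper_coloring R k (insert r (S - {r})) (c(r := i))"
        using proper_coloring_insert[OF R _ c, of r] psubset.hyps by blast
      then show False using no rfg by (auto simp: insert_absorb)
    qed
  qed
  then show ?thesis by blast
qed

section \<open>Edges in conflict\<close>

text \<open>The colourings of \<open>E\<close> that are proper for this relation are exactly the
  injective edge-colourings.\<close>

definition conflict :: "'a set set \<Rightarrow> 'a set \<Rightarrow> 'a set \<Rightarrow> bool" where
  "conflict E e f \<longleftrightarrow> (\<exists>m. consecutive E e m f)"

lemma conflict_path:
  assumes "distinct [a, b, c, d]" "{a, b} \<in> E" "{b, c} \<in> E" "{c, d} \<in> E"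
  shows "conflict E {a, b} {c, d}"
  using assms unfolding conflict_def consecutive_def path3_def by blast

lemma conflict_cases:
  assumes "conflict E e f"
  obtains (path) a b c d where "distinct [a, b, c, d]" "e = {a, b}" "f = {c, d}"
      "{a, b} \<in> E" "{b, c} \<in> E" "{c, d} \<in> E"
    | (cycle) a b c where "distinct [a, b, c]" "e = {a, b}" "f = {c, a}"
      "{a, b} \<in> E" "{b, c} \<in> E" "{c, a} \<in> E"
proof -
  obtain m where "path3 E e m f \<or> cycle3 E e m f"
    using assms unfolding conflict_def consecutive_def by blast
  then show thesis
  proof
    assume p: "path3 E e m f"
    then have "\<exists>a b c d. distinct [a, b, c, d] \<and> e = {a, b} \<and> m = {b, c} \<and> f = {c, d}"
      by (simp only: path3_def)
    then obtain a b c d where "distinct [a, b, c, d]" "e = {a, b}" "m = {b, c}" "f = {c, d}"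
      by (elim exE conjE) (rule that)
    then show thesis using p path[of a b c d] by (simp only: path3_def) simp
  next
    assume p: "cycle3 E e m f"
    then have "\<exists>a b c. distinct [a, b, c] \<and> e = {a, b} \<and> m = {b, c} \<and> f = {c, a}"
      by (simp only: cycle3_def)
    then obtain a b c where "distinct [a, b, c]" "e = {a, b}" "m = {b, c}" "f = {c, a}"
      by (elim exE conjE) (rule that)
    then show thesis using p cycle[of a b c] by (simp only: cycle3_def) simp
  qed
qed

lemma symp_conflict: "symp (conflict E)"
proof (rule sympI)
  fix e f assume "conflict E e f"
  then show "conflict E f e"
  proof (cases rule: conflict_cases)
    case (path a b c d)
    then show ?thesis
      using conflict_path[of d c b a E] by (auto simp: insert_commute)
  next
    case (cycle a b c)
    have "distinct [a, c, b] \<and> {c, a} = {a, c} \<and> {b, c} = {c, b} \<and> {a, b} = {b, a}"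
      using cycle(1) by auto
    then have "cycle3 E {c, a} {b, c} {a, b}"
      unfolding cycle3_def using cycle(4-6) by blast
    then show ?thesis unfolding conflict_def consecutive_def using cycle by blast
  qed
qed

lemma irreflp_conflict: "irreflp (conflict E)"
proof (rule irreflpI, rule notI)
  fix e assume "conflict E e e"
  then show False
    by (cases rule: conflict_cases) (auto simp: doubleton_eq_iff)
qed

section \<open>Counting the conflicts of an edge\<close>

definition nbrs :: "'a set set \<Rightarrow> 'a \<Rightarrow> 'a set" where
  "nbrs E v = {w. {v, w} \<in> E}"

text \<open>With \<open>A\<close> the neighbours of \<open>v\<close> other than the second end of an
  edge at \<open>v\<close>, this contains all edges in conflict with that edge through a middle edge
  at \<open>v\<close>. Requiring \<open>v \<notin> f\<close> discards the middle edges themselves,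
  so each \<open>w\<close> contributes at most its degree minus one.\<close>

definition edges_beyond :: "'a set set \<Rightarrow> 'a set \<Rightarrow> 'a \<Rightarrow> 'a set set" where
  "edges_beyond E A v = (\<Union>w\<in>A. {f \<in> E. w \<in> f \<and> v \<notin> f})"

text \<open>The cases tell at which end the middle edge is attached. The far vertex \<open>x\<close>
  may be the other end of the given edge, which is how triangles are covered.\<close>

lemma conflict_cases_at:
  assumes "conflict E {u, v} f"
  obtains (first) w x where "{u, w} \<in> E" "w \<noteq> v" "w \<noteq> u" "f = {w, x}" "f \<in> E" "x \<noteq> u"
    | (second) w x where "{v, w} \<in> E" "w \<noteq> u" "w \<noteq> v" "f = {w, x}" "f \<in> E" "x \<noteq> v"
proof -
  show thesis
    using assms
  proof (cases rule: conflict_cases)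
    case (path a b c d)
    then consider "u = a" "v = b" | "u = b" "v = a" by (auto simp: doubleton_eq_iff)
    then show thesis
      by cases (use path that(1)[of c d] that(2)[of c d] in auto)
  next
    case (cycle a b c)
    then consider "u = a" "v = b" | "u = b" "v = a" by (auto simp: doubleton_eq_iff)
    then show thesis
      by cases (use cycle that(1)[of c a] that(2)[of c a] in auto)
  qed
qed

lemma conflict_subset_edges_beyond:
  "{f. conflict E {u, v} f} \<subseteq>
    edges_beyond E (nbrs E u - {v}) u \<union> edges_beyond E (nbrs E v - {u}) v"
proof
  fix f assume "f \<in> {f. conflict E {u, v} f}"
  then have "conflict E {u, v} f" by simp
  then show "f \<in> edges_beyond E (nbrs E u - {v}) u \<union> edges_beyond E (nbrs E v - {u}) v"
    by (cases rule: conflict_cases_at) (auto simp: edges_beyond_def nbrs_def)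
qed

context simple_graph
begin

lemma finite_edges: "finite E"
  using finite_vertices edges by (auto intro: finite_subset[of E "Pow V"])

lemma edge_card: "e \<in> E \<Longrightarrow> card e = 2"
  using edges by auto

lemma no_loop: "{v, w} \<in> E \<Longrightarrow> v \<noteq> w"
  using edge_card[of "{v, w}"] by auto

lemma bij_betw_nbrs: "bij_betw (\<lambda>w. {v, w}) (nbrs E v) {e \<in> E. v \<in> e}"
proof (rule bij_betwI')
  show "\<exists>w\<in>nbrs E v. e = {v, w}" if "e \<in> {e \<in> E. v \<in> e}" for e
    using that edge_card[of e] by (auto simp: nbrs_def card_2_iff insert_commute)
qed (auto simp: nbrs_def doubleton_eq_iff)

lemma card_nbrs: "card (nbrs E v) = vdegree E v"
  using bij_betw_same_card[OF bij_betw_nbrs] by (simp add: vdegree_def)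

lemma finite_nbrs: "finite (nbrs E v)"
  using bij_betw_finite[OF bij_betw_nbrs] finite_edges by simp

lemma vdegree_le: "vdegree E v \<le> max_degree V E"
proof (cases "v \<in> V")
  case True
  then show ?thesis unfolding max_degree_def by (intro Max_ge) (auto simp: finite_vertices)
next
  case False
  then have "{e \<in> E. v \<in> e} = {}" using edges by auto
  then show ?thesis by (simp only: vdegree_def card.empty le0)
qed

lemma card_edges_beyond:
  assumes "A \<subseteq> nbrs E v"
  shows "card (edges_beyond E A v) \<le> (\<Sum>w\<in>A. vdegree E w - 1)"
proof -
  have "card (edges_beyond E A v) \<le> (\<Sum>w\<in>A. card {f \<in> E. w \<in> f \<and> v \<notin> f})"
    unfolding edges_beyond_def using assms finite_nbrs by (intro card_UN_le) (auto intro: finite_subset)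
  also have "\<dots> \<le> (\<Sum>w\<in>A. vdegree E w - 1)"
  proof (rule sum_mono)
    fix w assume "w \<in> A"
    then have "{v, w} \<in> E" using assms by (auto simp: nbrs_def)
    have "card {f \<in> E. w \<in> f \<and> v \<notin> f} \<le> card ({f \<in> E. w \<in> f} - {{v, w}})"
      using finite_edges by (intro card_mono) auto
    also have "\<dots> = vdegree E w - 1"
      using \<open>{v, w} \<in> E\<close> by (subst card_Diff_singleton) (simp_all add: vdegree_def)
    finally show "card {f \<in> E. w \<in> f \<and> v \<notin> f} \<le> vdegree E w - 1" .
  qed
  finally show ?thesis .
qed

lemma card_edges_beyond_le:
  assumes "A \<subseteq> nbrs E v"
  shows "card (edges_beyond E A v) \<le> card A * (max_degree V E - 1)"
proof -
  have "(\<Sum>w\<in>A. vdegree E w - 1) \<le> (\<Sum>w\<in>A. max_degree V E - 1)"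
    by (intro sum_mono diff_le_mono vdegree_le)
  then show ?thesis using card_edges_beyond[OF assms] by simp
qed

lemma card_nbrs_Diff: "{u, v} \<in> E \<Longrightarrow> card (nbrs E u - {v}) = vdegree E u - 1"
  by (simp add: nbrs_def flip: card_nbrs)

lemma card_edges_beyond_edge:
  assumes "{u, v} \<in> E"
  shows "card (edges_beyond E (nbrs E u - {v}) u) \<le> (max_degree V E - 1)\<^sup>2"
proof -
  have "card (edges_beyond E (nbrs E u - {v}) u) \<le> (vdegree E u - 1) * (max_degree V E - 1)"
    using card_edges_beyond_le[of "nbrs E u - {v}" u] card_nbrs_Diff[OF assms] by simp
  also have "\<dots> \<le> (max_degree V E - 1)\<^sup>2"
    unfolding power2_eq_square by (intro mult_le_mono diff_le_mono vdegree_le order_refl)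
  finally show ?thesis .
qed

lemma finite_edges_beyond: "finite (edges_beyond E A v)"
  using finite_edges by (rule finite_subset[rotated]) (auto simp: edges_beyond_def)

lemma conflict_in_edges: "conflict E e f \<Longrightarrow> f \<in> E"
  by (erule conflict_cases) simp_all

lemma finite_conflict: "finite {f. conflict E e f}"
  using finite_edges by (rule finite_subset[rotated]) (auto dest: conflict_in_edges)

lemma card_conflict_le_edges_beyond:
  "card {f. conflict E {u, v} f} \<le>
    card (edges_beyond E (nbrs E u - {v}) u) + card (edges_beyond E (nbrs E v - {u}) v)"
  using card_mono[OF _ conflict_subset_edges_beyond, of E u v] card_Un_le finite_edges_beyond
  by (meson finite_UnI order_trans)

text \<open>Each of the two ends has at most \<open>D - 1\<close> further neighbours, each with at
  most \<open>D - 1\<close> further edges, where \<open>D\<close> is the maximum degree.\<close>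

lemma card_conflict_le:
  assumes "e \<in> E"
  shows "card {f. conflict E e f} \<le> 2 * (max_degree V E - 1)\<^sup>2"
proof -
  obtain u v where e: "e = {u, v}" using edge_card[OF assms] by (auto simp: card_2_iff)
  then have "{u, v} \<in> E" "{v, u} \<in> E" using assms by (auto simp: insert_commute)
  then show ?thesis
    using card_conflict_le_edges_beyond[of u v] card_edges_beyond_edge[of u v]
      card_edges_beyond_edge[of v u] e by simp
qed

section \<open>Consequences of equality in the conflict bound\<close>

lemma saturated_edges_beyond:
  assumes "{u, v} \<in> E" "card {f. conflict E {u, v} f} = 2 * (max_degree V E - 1)\<^sup>2"
  shows "card (edges_beyond E (nbrs E u - {v}) u) = (max_degree V E - 1)\<^sup>2"
proof -
  have "{v, u} \<in> E" using assms by (simp add: insert_commute)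
  then show ?thesis
    using card_conflict_le_edges_beyond[of u v] card_edges_beyond_edge[of u v]
      card_edges_beyond_edge[of v u] assms by simp
qed

lemma saturated_vdegree:
  assumes "{u, v} \<in> E" "card {f. conflict E {u, v} f} = 2 * (max_degree V E - 1)\<^sup>2"
    and D: "max_degree V E \<ge> 3"
  shows "vdegree E u = max_degree V E"
proof (rule ccontr)
  assume "vdegree E u \<noteq> max_degree V E"
  then have "vdegree E u - 1 < max_degree V E - 1" using vdegree_le[of u] D by simp
  then have "(vdegree E u - 1) * (max_degree V E - 1) < (max_degree V E - 1)\<^sup>2"
    unfolding power2_eq_square using D by simp
  then show False
    using saturated_edges_beyond[OF assms(1,2)] card_edges_beyond_le[of "nbrs E u - {v}" u]
      card_nbrs_Diff[OF assms(1)] by simp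
qed

text \<open>A single neighbour of smaller degree makes the sum over the neighbours of
  \<open>u\<close> strictly smaller than the value forced by equality.\<close>

lemma saturated_vdegree_nbr:
  assumes "{u, v} \<in> E" "card {f. conflict E {u, v} f} = 2 * (max_degree V E - 1)\<^sup>2"
    and D: "max_degree V E \<ge> 3" and w: "{u, w} \<in> E"
  shows "vdegree E w = max_degree V E"
proof (cases "w = v")
  case True
  then show ?thesis
    using saturated_vdegree[of v u] assms by (simp add: insert_commute)
next
  case False
  show ?thesis
  proof (rule ccontr)
    assume "vdegree E w \<noteq> max_degree V E"
    then have lt: "vdegree E w - 1 < max_degree V E - 1" using vdegree_le[of w] D by simp
    have "(\<Sum>w\<in>nbrs E u - {v}. vdegree E w - 1) < (\<Sum>w\<in>nbrs E u - {v}. max_degree V E - 1)"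
      using finite_nbrs False w lt
      by (intro sum_strict_mono_ex1) (auto simp: nbrs_def vdegree_le diff_le_mono)
    also have "\<dots> = (max_degree V E - 1)\<^sup>2"
      using card_nbrs_Diff[OF assms(1)] saturated_vdegree[OF assms(1-3)]
      by (simp add: power2_eq_square)
    finally show False
      using saturated_edges_beyond[OF assms(1,2)] card_edges_beyond[of "nbrs E u - {v}" u] by simp
  qed
qed

text \<open>For a common neighbour \<open>t\<close> of \<open>u\<close> and \<open>v\<close>, the edges at \<open>t\<close> account for \<open>2 (D - 1)\<close>
  in the bound, although there are at most \<open>D < 2 (D - 1)\<close> of them.\<close>

lemma saturated_no_triangle:
  assumes uv: "{u, v} \<in> E" and "card {f. conflict E {u, v} f} = 2 * (max_degree V E - 1)\<^sup>2"
    and D: "max_degree V E \<ge> 3" and ut: "{u, t} \<in> E"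
  shows "{v, t} \<notin> E"
proof
  assume vt: "{v, t} \<in> E"
  have vu: "{v, u} \<in> E" using uv by (simp add: insert_commute)
  have "t \<noteq> u" "t \<noteq> v" using no_loop ut vt by blast+
  let ?D = "max_degree V E" and ?T = "{f \<in> E. t \<in> f}"
  let ?X = "edges_beyond E (nbrs E u - {v} - {t}) u"
  let ?Y = "edges_beyond E (nbrs E v - {u} - {t}) v"
  have bound: "card (edges_beyond E (nbrs E a - {b} - {t}) a) \<le> (?D - 2) * (?D - 1)"
    if "{a, b} \<in> E" "{a, t} \<in> E" "t \<noteq> b" for a b
  proof -
    have "card (nbrs E a - {b} - {t}) = vdegree E a - 2"
      using that finite_nbrs card_nbrs_Diff[of a b]
      by (subst card_Diff_singleton) (auto simp: nbrs_def)
    also have "\<dots> \<le> ?D - 2" by (intro diff_le_mono vdegree_le)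
    finally have "card (nbrs E a - {b} - {t}) * (?D - 1) \<le> (?D - 2) * (?D - 1)" by simp
    moreover have "nbrs E a - {b} - {t} \<subseteq> nbrs E a" by blast
    ultimately show ?thesis
      using card_edges_beyond_le order_trans by blast
  qed
  have "{f. conflict E {u, v} f} \<subseteq> ?X \<union> ?Y \<union> ?T"
    using conflict_subset_edges_beyond[of E u v] by (auto simp: edges_beyond_def)
  then have "card {f. conflict E {u, v} f} \<le> card (?X \<union> ?Y \<union> ?T)"
    using finite_edges finite_edges_beyond by (intro card_mono) auto
  also have "\<dots> \<le> card ?X + card ?Y + card ?T"
    by (meson add_le_mono card_Un_le order_refl order_trans)
  also have "\<dots> \<le> (?D - 2) * (?D - 1) + (?D - 2) * (?D - 1) + ?D"
    using bound[of u v] bound[of v u] uv vu ut vt \<open>t \<noteq> u\<close> \<open>t \<noteq> v\<close> vdegree_le[of t]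
    by (intro add_le_mono) (auto simp: vdegree_def)
  \<comment> \<open>Substituting \<open>d + 3\<close> for the maximum degree removes the truncated
    subtractions; the two sides then differ by \<open>d + 1\<close>.\<close>
  also have "\<dots> < 2 * (?D - 1)\<^sup>2"
  proof -
    obtain d where "?D = d + 3" using D by (metis add.commute le_Suc_ex)
    then show ?thesis by (simp add: power2_eq_square algebra_simps)
  qed
  finally show False using assms(2) by simp
qed

lemma obtain_nbr:
  assumes "vdegree E v \<ge> 3"
  obtains w where "{v, w} \<in> E" "w \<noteq> a" "w \<noteq> b" "w \<noteq> v"
proof -
  have "card {a, b} < card (nbrs E v)"
    using assms by (simp add: card_nbrs card_insert_if)
  then have "\<not> nbrs E v \<subseteq> {a, b}"
    using card_mono[of "{a, b}" "nbrs E v"] by auto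
  then obtain w where "w \<in> nbrs E v" "w \<noteq> a" "w \<noteq> b" by blast
  then show thesis using that[of w] no_loop[of v w] by (simp add: nbrs_def)
qed

end

section \<open>Sets of edges with maximally many conflicts\<close>

text \<open>The counting enters the rest of the argument only through these properties. Closure
  makes \<open>S\<close> a union of components of the conflict relation, and
  \<open>no_triangle\<close> says that no triangle of the graph has an edge in
  \<open>S\<close>.\<close>

locale saturated_edge_set = simple_graph V E for V :: "'a set" and E +
  fixes S :: "'a set set"
  assumes S_subset: "S \<subseteq> E"
    and S_closed: "e \<in> S \<Longrightarrow> conflict E e f \<Longrightarrow> f \<in> S"
    and no_triangle: "{a, b} \<in> S \<Longrightarrow> {b, c} \<in> E \<Longrightarrow> {a, c} \<notin> E"
    and degree3: "{a, b} \<in> S \<Longrightarrow> {a, c} \<in> E \<Longrightarrow> vdegree E c \<ge> 3"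
begin

text \<open>Both arguments avoid \<open>f\<close> and \<open>g\<close>, which makes the relation
  symmetric, so that chains can be reversed; the relation in \<open>brooks_coloring\<close>
  restricts only its target.\<close>

definition link :: "'a set \<Rightarrow> 'a set \<Rightarrow> 'a set \<Rightarrow> 'a set \<Rightarrow> bool" where
  "link f g e e' \<longleftrightarrow> conflict E e e' \<and> e \<in> S - {f, g} \<and> e' \<in> S - {f, g}"

lemma link_sym: "(link f g)\<^sup>*\<^sup>* e e' \<Longrightarrow> (link f g)\<^sup>*\<^sup>* e' e"
proof -
  have "symp (link f g)"
    using symp_conflict[of E] by (auto simp: symp_def link_def)
  then show "(link f g)\<^sup>*\<^sup>* e e' \<Longrightarrow> (link f g)\<^sup>*\<^sup>* e' e"
    using symp_rtranclp[of "link f g"] by (auto dest: sympD)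
qed

lemma link_path:
  assumes "{a, b} \<in> S" "distinct [a, b, c, d]" "{b, c} \<in> E" "{c, d} \<in> E"
    and "{a, b} \<notin> {f, g}" "{c, d} \<notin> {f, g}"
  shows "link f g {a, b} {c, d}" "{c, d} \<in> S"
proof -
  have "conflict E {a, b} {c, d}"
    using assms S_subset by (intro conflict_path) auto
  then show "link f g {a, b} {c, d}" "{c, d} \<in> S"
    using S_closed[OF assms(1)] assms by (auto simp: link_def)
qed

lemma degree_ends:
  assumes "{a, b} \<in> S"
  shows "vdegree E a \<ge> 3" "vdegree E b \<ge> 3"
  using degree3[of b a a] degree3[of a b b] assms S_subset by (auto simp: insert_commute)

text \<open>As \<open>f\<close> and \<open>g\<close> share the vertex \<open>w\<close>, every edge not containing \<open>w\<close> is allowed as an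
  intermediate step.\<close>

lemma link_to_hub:
  assumes uv: "{u, v} \<in> S" and uw: "{u, w} \<in> E" and "v \<noteq> w" and w: "w \<in> f" "w \<in> g"
    and avoid: "{u, w} \<notin> {f, g}"
  shows "(link f g)\<^sup>*\<^sup>* {u, v} {u, w}" "{u, w} \<in> S"
proof -
  have "{u, v} \<in> E" using uv S_subset by auto
  then have ne: "u \<noteq> v" "u \<noteq> w" using no_loop uw by auto
  \<comment> \<open>The edges \<open>uv\<close> and \<open>uw\<close> meet in \<open>u\<close>, so a
    detour is taken: \<open>v'a\<close> is in conflict with both of them through the middle edge
    \<open>uv'\<close>.\<close>
  obtain v' where v': "{u, v'} \<in> E" "v' \<noteq> v" "v' \<noteq> w" "v' \<noteq> u"
    using obtain_nbr degree_ends(1)[OF uv] by metis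
  obtain a where a: "{v', a} \<in> E" "a \<noteq> u" "a \<noteq> w" "a \<noteq> v'"
    using obtain_nbr degree3[OF uv v'(1)] by metis
  have "a \<noteq> v"
    using no_triangle[of v u v'] uv v' a by (auto simp: insert_commute)
  have out: "{v, u} \<notin> {f, g}" "{v', a} \<notin> {f, g}" "{a, v'} \<notin> {f, g}"
    using w a v' ne \<open>v \<noteq> w\<close> by auto
  have 1: "link f g {v, u} {v', a}" "{v', a} \<in> S"
    using link_path[of v u v' a f g] uv v' a ne \<open>a \<noteq> v\<close> out by (auto simp: insert_commute)
  have 2: "link f g {a, v'} {u, w}" "{u, w} \<in> S"
    using link_path[of a v' u w f g] 1 v' a ne avoid uw out by (auto simp: insert_commute)
  show "(link f g)\<^sup>*\<^sup>* {u, v} {u, w}" "{u, w} \<in> S"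
    using 1(1) 2 by (auto simp: insert_commute)
qed

text \<open>An edge \<open>xy\<close> with \<open>y \<noteq> w\<close> is in conflict with every
  edge of \<open>S\<close> at \<open>w\<close> other than \<open>f\<close> and \<open>g\<close>, so
  such edges tie the star at \<open>w\<close> together. It remains to get from \<open>e\<close>
  either to this star or to an edge at \<open>x\<close>.\<close>

lemma hub_to_conflict:
  assumes f: "f = {w, x}" "f \<in> S" and g: "g = {w, x'}" and wx': "{w, x'} \<in> E"
    and hub: "{u, w} \<in> S" and distinct: "distinct [u, x, x']"
    and e: "e \<in> S - {f, g}" "conflict E f e"
  shows "(link f g)\<^sup>*\<^sup>* {u, w} e"
proof -
  have wx: "{w, x} \<in> E" "{x, w} \<in> S" "{x, w} \<in> E" and uw: "{u, w} \<in> E" "{w, u} \<in> E"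
    using f hub S_subset by (auto simp: insert_commute)
  have ne: "w \<noteq> x" "w \<noteq> x'" "u \<noteq> w" using wx wx' uw no_loop by auto
  have no_tri: "{w, y} \<notin> E" if "{x, y} \<in> E" for y
    using no_triangle[of w x y] f that by auto
  have hub_out: "{u, w} \<notin> {f, g}" using f g distinct ne by (auto simp: doubleton_eq_iff)
  \<comment> \<open>The middle edge is \<open>f\<close> itself: \<open>f\<close> is excluded as a
    member of a chain, but not as a middle edge.\<close>
  have to_x: "(link f g)\<^sup>*\<^sup>* {u', w} {x, y}" "{x, y} \<in> S"
    if "{u', w} \<in> S" "{u', w} \<notin> {f, g}" "{x, y} \<in> E" "y \<noteq> w" for u' y
  proof -
    have E: "{u', w} \<in> E" using that S_subset by auto
    have "u' \<noteq> w" "x \<noteq> y" using E that no_loop by auto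
    moreover have "u' \<noteq> x" using that f by (auto simp: insert_commute)
    moreover have "u' \<noteq> y" using no_tri[of y] that E by (auto simp: insert_commute)
    moreover have "{x, y} \<notin> {f, g}" using f g that ne by auto
    ultimately show "(link f g)\<^sup>*\<^sup>* {u', w} {x, y}" "{x, y} \<in> S"
      using link_path[of u' w x y f g] that wx ne by auto
  qed
  obtain y where y: "{x, y} \<in> E" "y \<noteq> w"
    using obtain_nbr degree_ends(1)[OF wx(2)] by metis
  have "conflict E {w, x} e" using e f by simp
  then show ?thesis
  proof (cases rule: conflict_cases_at)
    case (first u' v')
    show ?thesis
    proof (cases "u' = x'")
      case True
      \<comment> \<open>Here \<open>u'w\<close> is the excluded edge \<open>g\<close>, so the hub
        lemma cannot be used; instead \<open>e\<close> is in conflict with \<open>uw\<close>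
        directly, with \<open>g\<close> as middle edge.\<close>
      have "v' \<noteq> u"
        using no_triangle[of u w x'] hub first True wx' by (auto simp: insert_commute)
      then have "link f g {u, w} {x', v'}"
        using link_path[of u w x' v' f g] first True hub hub_out wx' e distinct ne no_loop[of x' v']
        by auto
      then show ?thesis using first True by auto
    next
      case False
      have out: "{u', w} \<notin> {f, g}"
        using False first f g by (auto simp: doubleton_eq_iff)
      \<comment> \<open>The chain runs from \<open>uw\<close> to \<open>xy\<close>, on to
        \<open>u'w\<close> and from there to \<open>e\<close>.\<close>
      have hub': "(link f g)\<^sup>*\<^sup>* {u', v'} {u', w}" "{u', w} \<in> S"
        using link_to_hub[of u' v' w f g] e first f g out by (auto simp: insert_commute)
      have "(link f g)\<^sup>*\<^sup>* {u, w} {x, y}" "(link f g)\<^sup>*\<^sup>* {u', w} {x, y}"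
        using to_x hub hub' hub_out out y by auto
      then have "(link f g)\<^sup>*\<^sup>* {u, w} {u', w}"
        using link_sym rtranclp_trans by metis
      then show ?thesis using link_sym[OF hub'(1)] first(4) by (auto intro: rtranclp_trans)
    qed
  next
    case (second z p)
    have zp: "{z, p} \<in> E" using second by simp
    have xz: "{x, z} \<in> S" using to_x[of u z] hub hub_out second by auto
    have "p \<noteq> w" using no_tri[of z] second by (auto simp: insert_commute)
    \<comment> \<open>The edge \<open>xz\<close> meets \<open>e\<close> in \<open>z\<close>, so
      another edge \<open>xz'\<close> is used: it is in conflict with \<open>e\<close> through
      \<open>xz\<close> and linked to \<open>uw\<close> by \<open>to_x\<close>.\<close>
    obtain z' where z': "{x, z'} \<in> E" "z' \<noteq> w" "z' \<noteq> z" "z' \<noteq> x"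
      using obtain_nbr degree_ends(1)[OF xz] by metis
    have hub_z': "(link f g)\<^sup>*\<^sup>* {u, w} {x, z'}" "{z', x} \<in> S"
      using to_x[of u z'] hub hub_out z' by (auto simp: insert_commute)
    have "p \<noteq> z'" using no_triangle[of z' x z] hub_z' second zp by (auto simp: insert_commute)
    moreover have "{z', x} \<notin> {f, g}" using f g z' ne by auto
    ultimately have "link f g {z', x} {z, p}"
      using link_path[of z' x z p f g] hub_z' second zp z' no_loop[OF zp] e by auto
    then show ?thesis using hub_z' second(4) by (auto simp: insert_commute)
  qed
qed

lemma brooks_triple:
  assumes "S \<noteq> {}"
  shows "\<exists>r f g. {r, f, g} \<subseteq> S \<and> f \<noteq> g \<and> conflict E r f \<and> conflict E r g \<and> \<not> conflict E f g \<and>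
    (\<forall>e \<in> S - {f, g}. conflict E f e \<or> conflict E g e \<longrightarrow>
      (\<lambda>a b. conflict E a b \<and> b \<in> S - {f, g})\<^sup>*\<^sup>* r e)"
proof -
  obtain w x where wx: "{w, x} \<in> S"
    using assms S_subset edge_card by (metis card_2_iff equals0I subsetD)
  obtain x' where x': "{w, x'} \<in> E" "x' \<noteq> x" "x' \<noteq> w"
    using obtain_nbr degree_ends(1)[OF wx] by metis
  obtain u where u: "{w, u} \<in> E" "u \<noteq> x" "u \<noteq> x'" "u \<noteq> w"
    using obtain_nbr degree_ends(1)[OF wx] by metis
  obtain v where v: "{u, v} \<in> E" "v \<noteq> w" "v \<noteq> x'" "v \<noteq> u"
    using obtain_nbr degree3[OF wx u(1)] by metis
  let ?f = "{w, x}" and ?g = "{w, x'}" and ?r = "{v, u}"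
  have E: "{w, x} \<in> E" "{u, w} \<in> E" "{v, u} \<in> E"
    using wx S_subset u v by (auto simp: insert_commute)
  have "w \<noteq> x" using no_loop E by auto
  have "v \<noteq> x" using no_triangle[of x w u] wx u v by (auto simp: insert_commute)
  have rf: "conflict E ?r ?f" and rg: "conflict E ?r ?g"
    using conflict_path[of v u w x E] conflict_path[of v u w x' E] E u v x' \<open>v \<noteq> x\<close> \<open>w \<noteq> x\<close>
    by auto
  have r: "?r \<in> S" using S_closed[OF wx] rf symp_conflict[of E] by (auto dest: sympD)
  have g: "?g \<in> S" using S_closed[OF r rg] .
  have hub: "(link ?f ?g)\<^sup>*\<^sup>* ?r {u, w}" "{u, w} \<in> S"
    using link_to_hub[of u v w ?f ?g] r E u v by (auto simp: insert_commute doubleton_eq_iff)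
  \<comment> \<open>Two edges with a common vertex are in conflict only inside a triangle.\<close>
  have "\<not> conflict E ?f ?g"
  proof
    assume "conflict E ?f ?g"
    then show False
    proof (cases rule: conflict_cases)
      case (cycle a b c)
      then show False using no_triangle[of a b c] wx by (auto simp: insert_commute)
    qed (auto simp: doubleton_eq_iff)
  qed
  moreover have "(\<lambda>a b. conflict E a b \<and> b \<in> S - {?f, ?g})\<^sup>*\<^sup>* ?r e"
    if e: "e \<in> S - {?f, ?g}" "conflict E ?f e \<or> conflict E ?g e" for e
  proof -
    have "(link ?f ?g)\<^sup>*\<^sup>* {u, w} e"
      using e(2)
    proof
      assume "conflict E ?f e"
      then show ?thesis
        using hub_to_conflict[of ?f w x ?g x' u e] e wx x' hub u by auto
    next
      assume "conflict E ?g e"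
      then have "(link ?g ?f)\<^sup>*\<^sup>* {u, w} e"
        using hub_to_conflict[of ?g w x' ?f x u e] e g E x' hub u by auto
      moreover have "link ?g ?f = link ?f ?g" by (auto simp: link_def fun_eq_iff)
      ultimately show ?thesis by simp
    qed
    then have "(link ?f ?g)\<^sup>*\<^sup>* ?r e" using hub by auto
    then show ?thesis
      by (rule rtranclp_mono[THEN predicate2D, rotated]) (auto simp: link_def)
  qed
  ultimately show ?thesis
    using r g wx rf rg x' by (intro exI[of _ ?r] exI[of _ ?f] exI[of _ ?g]) (auto simp: doubleton_eq_iff)
qed

end

text \<open>The conflicts of an edge of \<open>S\<close> inside \<open>S\<close> already reach the
  global maximum, so there are none outside \<open>S\<close>. This gives closure and lets the
  results on equality apply to every edge of \<open>S\<close>.\<close>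

lemma (in simple_graph) saturated_edge_setI:
  assumes D: "max_degree V E \<ge> 3" and S: "S \<subseteq> E"
    and regular: "\<And>e. e \<in> S \<Longrightarrow> card {f \<in> S. conflict E e f} = 2 * (max_degree V E - 1)\<^sup>2"
  shows "saturated_edge_set V E S"
proof
  show "S \<subseteq> E" by fact
  have sub: "{f \<in> S. conflict E e f} = {f. conflict E e f}" if "e \<in> S" for e
    using regular[OF that] card_conflict_le[of e] that S finite_conflict[of e]
    by (intro card_seteq) auto
  then show "f \<in> S" if "e \<in> S" "conflict E e f" for e f
    using that by blast
  have sat: "card {f. conflict E e f} = 2 * (max_degree V E - 1)\<^sup>2" if "e \<in> S" for e
    using regular[OF that] sub[OF that] by simp
  show "{a, c} \<notin> E" if "{a, b} \<in> S" "{b, c} \<in> E" for a b c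
    using saturated_no_triangle[of b a c] that sat D S by (auto simp: insert_commute)
  show "3 \<le> vdegree E c" if "{a, b} \<in> S" "{a, c} \<in> E" for a b c
    using saturated_vdegree_nbr[of a b c] that sat D S by auto
qed

theorem theorem1p9:
  fixes V :: "'a set" and E :: "'a set set"
  assumes "simple_graph V E"
    and "max_degree V E \<ge> 3"
  shows "injective_chromatic_index E \<le> 2 * (max_degree V E - 1)\<^sup>2"
proof -
  interpret simple_graph V E by fact
  let ?k = "2 * (max_degree V E - 1)\<^sup>2"
  have "\<exists>c. proper_coloring (conflict E) ?k E c"
  proof (rule brooks_coloring[OF symp_conflict irreflp_conflict finite_edges])
    show "?k > 0" using assms(2) by simp
    show "card {f \<in> E. conflict E e f} \<le> ?k" if "e \<in> E" for e
    proof -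
      have "{f \<in> E. conflict E e f} = {f. conflict E e f}" by (auto dest: conflict_in_edges)
      then show ?thesis using card_conflict_le[OF that] by simp
    qed
    fix S assume S: "S \<subseteq> E" "S \<noteq> {}"
      and regular: "\<And>e. e \<in> S \<Longrightarrow> card {f \<in> S. conflict E e f} = ?k"
    interpret saturated_edge_set V E S
      using saturated_edge_setI[OF assms(2) S(1) regular] .
    show "\<exists>r f g. {r, f, g} \<subseteq> S \<and> f \<noteq> g \<and> conflict E r f \<and> conflict E r g \<and> \<not> conflict E f g \<and>
        (\<forall>e \<in> S - {f, g}. conflict E f e \<or> conflict E g e \<longrightarrow>
          (\<lambda>a b. conflict E a b \<and> b \<in> S - {f, g})\<^sup>*\<^sup>* r e)"
      by (rule brooks_triple[OF S(2)])
  qed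
  then obtain c where c: "proper_coloring (conflict E) ?k E c" by blast
  have "e1 \<in> E" "e3 \<in> E" if "consecutive E e1 e2 e3" for e1 e2 e3
    using that by (auto simp: consecutive_def path3_def cycle3_def)
  then have "injective_edge_coloring E ?k c"
    using c unfolding injective_edge_coloring_def proper_coloring_def conflict_def by blast
  then show ?thesis unfolding injective_chromatic_index_def by (intro Least_le) blast
qed

end
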